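(* Let $(\mathcal K,T)$ be a colax idempotent 2-monad on a 2-category $\mathcal K$ with comma objects. Then any colax morphism of pseudo $T$-algebras is exact.
   Context: A 2-monad $T$ on $\mathcal K$, with unit $\eta$ and multiplication $\mu$, is colax idempotent when $\eta T \dashv \mu$. A pseudo $T$-algebra is $(A,a)$ with $a : TA \to A$ and invertible 2-cells $a_0 : 1_A \to a\eta_A$, $a_2 : aT(a) \to a\mu_A$ satisfying $(a_2\eta_{TA})(a_0a) = \mathrm{id}$, $(a_2T(\eta_A))(aT(a_0)) = \mathrm{id}$ and $(a_2\mu_{TA})(a_2T^2(a)) = (a_2T(\mu_A))(aT(a_2))$. A colax morphism $(f,\overline f) : (A,a) \to (B,b)$ is $f : A \to B$ with a 2-cell $\overline f : fa \to bT(f)$ satisfying the unit axiom $(\overline f\eta_A)(fa_0) = b_0f$ and the structure axiom $(b_2T^2(f))(bT(\overline f))(\overline fT(a)) = (\overline f\mu_A)(fa_2)$. A 2-cell $\psi : g \to hf$ (with $f : X \to Y$, $g : X \to A$, $h : Y \to A$) exhibits $h$ as a left Kan extension of $g$ along $f$ if for every $k : Y \to A$, pasting with $\psi$ is a bijection between 2-cells $h \to k$ and 2-cells $g \to kf$. It is pointwise if for every $k : Z \to Y$, with comma square $p : f\downarrow k \to X$, $q : f \downarrow k \to Z$, $\lambda : fp \to kq$, the 2-cell $(h\lambda)(\psi p) : gp \to hkq$ exhibits $hk$ as a left Kan extension of $gp$ along $q$. A lax square $p : P \to A$, $q : P \to B$, $f : A \to C$, $g : B \to C$, $\phi : fp \to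 gq$ is exact if for every $\psi : h \to lf$ exhibiting $l$ as a pointwise left Kan extension of $h$ along $f$, the 2-cell $(l\phi)(\psi p) : hp \to lgq$ exhibits $lg$ as a pointwise left Kan extension of $hp$ along $q$. A colax morphism $(f,\overline f) : (A,a) \to (B,b)$ is exact if the lax square with $P = TA$, $p = a$, $q = Tf$, bottom $f : A \to B$, right side $b : TB \to B$ and 2-cell $\overline f : fa \to bT(f)$ is exact. *)

theory Defs
  imports Main
begin

section \<open>Strict 2-categories\<close>

record ('o, 'm, 'c) two_cat =
  Obj  :: "'o set"
  Arr  :: "'m set"
  Cell :: "'c set"
  Src  :: "'m \<Rightarrow> 'o"
  Tgt  :: "'m \<Rightarrow> 'o"
  Dom  :: "'c \<Rightarrow> 'm"
  Cod  :: "'c \<Rightarrow> 'm"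
  ida  :: "'o \<Rightarrow> 'm"
  cmp  :: "'m \<Rightarrow> 'm \<Rightarrow> 'm" (infixr \<open>\<cdot>\<index>\<close> 75)
  idc  :: "'m \<Rightarrow> 'c"
  vcmp :: "'c \<Rightarrow> 'c \<Rightarrow> 'c" (infixr \<open>\<bullet>\<index>\<close> 65)
  hcmp :: "'c \<Rightarrow> 'c \<Rightarrow> 'c" (infixr \<open>\<star>\<index>\<close> 70)

text \<open>All compositions are written in applicative order: \<open>g \<cdot> f\<close> is ``first \<open>f\<close>, then \<open>g\<close>'', and
  likewise for vertical (\<open>\<bullet>\<close>) and horizontal (\<open>\<star>\<close>) composition of 2-cells.\<close>

definition hom :: "('o, 'm, 'c) two_cat \<Rightarrow> 'o \<Rightarrow> 'o \<Rightarrow> 'm set" where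
  "hom K A B = {f \<in> Arr K. Src K f = A \<and> Tgt K f = B}"

definition cells :: "('o, 'm, 'c) two_cat \<Rightarrow> 'm \<Rightarrow> 'm \<Rightarrow> 'c set" where
  "cells K f g = {\<alpha> \<in> Cell K. Dom K \<alpha> = f \<and> Cod K \<alpha> = g}"

abbreviation lwhisker :: "('o, 'm, 'c) two_cat \<Rightarrow> 'm \<Rightarrow> 'c \<Rightarrow> 'c" (infixr \<open>\<rhd>\<index>\<close> 70) where
  "lwhisker K g \<alpha> \<equiv> hcmp K (idc K g) \<alpha>"

abbreviation rwhisker :: "('o, 'm, 'c) two_cat \<Rightarrow> 'c \<Rightarrow> 'm \<Rightarrow> 'c" (infixl \<open>\<lhd>\<index>\<close> 70) where
  "rwhisker K \<alpha> f \<equiv> hcmp K \<alpha> (idc K f)"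

locale two_category =
  fixes K :: "('o, 'm, 'c) two_cat" (structure)
  assumes Src_in: "f \<in> Arr K \<Longrightarrow> Src K f \<in> Obj K"
    and Tgt_in: "f \<in> Arr K \<Longrightarrow> Tgt K f \<in> Obj K"
    and Dom_in: "\<alpha> \<in> Cell K \<Longrightarrow> Dom K \<alpha> \<in> Arr K"
    and Cod_in: "\<alpha> \<in> Cell K \<Longrightarrow> Cod K \<alpha> \<in> Arr K"
    and Src_parallel: "\<alpha> \<in> Cell K \<Longrightarrow> Src K (Cod K \<alpha>) = Src K (Dom K \<alpha>)"
    and Tgt_parallel: "\<alpha> \<in> Cell K \<Longrightarrow> Tgt K (Cod K \<alpha>) = Tgt K (Dom K \<alpha>)"
    and ida_hom: "A \<in> Obj K \<Longrightarrow> ida K A \<in> hom K A A"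
    and cmp_hom: "\<lbrakk>f \<in> hom K A B; g \<in> hom K B C\<rbrakk> \<Longrightarrow> g \<cdot> f \<in> hom K A C"
    and cmp_ida_right: "f \<in> hom K A B \<Longrightarrow> f \<cdot> ida K A = f"
    and cmp_ida_left: "f \<in> hom K A B \<Longrightarrow> ida K B \<cdot> f = f"
    and cmp_assoc: "\<lbrakk>f \<in> hom K A B; g \<in> hom K B C; h \<in> hom K C D\<rbrakk> \<Longrightarrow> (h \<cdot> g) \<cdot> f = h \<cdot> (g \<cdot> f)"
    and idc_cells: "f \<in> Arr K \<Longrightarrow> idc K f \<in> cells K f f"
    and vcmp_cells: "\<lbrakk>\<alpha> \<in> cells K f g; \<beta> \<in> cells K g h\<rbrakk> \<Longrightarrow> \<beta> \<bullet> \<alpha> \<in> cells K f h"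
    and vcmp_idc_right: "\<alpha> \<in> cells K f g \<Longrightarrow> \<alpha> \<bullet> idc K f = \<alpha>"
    and vcmp_idc_left: "\<alpha> \<in> cells K f g \<Longrightarrow> idc K g \<bullet> \<alpha> = \<alpha>"
    and vcmp_assoc: "\<lbrakk>\<alpha> \<in> cells K f g; \<beta> \<in> cells K g h; \<gamma> \<in> cells K h k\<rbrakk>
      \<Longrightarrow> (\<gamma> \<bullet> \<beta>) \<bullet> \<alpha> = \<gamma> \<bullet> (\<beta> \<bullet> \<alpha>)"
    and hcmp_cells: "\<lbrakk>\<alpha> \<in> cells K f f'; f \<in> hom K A B; \<beta> \<in> cells K g g'; g \<in> hom K B C\<rbrakk>
      \<Longrightarrow> \<beta> \<star> \<alpha> \<in> cells K (g \<cdot> f) (g' \<cdot> f')"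
    and hcmp_idc: "\<lbrakk>f \<in> hom K A B; g \<in> hom K B C\<rbrakk> \<Longrightarrow> idc K g \<star> idc K f = idc K (g \<cdot> f)"
    and interchange: "\<lbrakk>f \<in> hom K A B; \<alpha> \<in> cells K f f'; \<alpha>' \<in> cells K f' f'';
        g \<in> hom K B C; \<beta> \<in> cells K g g'; \<beta>' \<in> cells K g' g''\<rbrakk>
      \<Longrightarrow> (\<beta>' \<bullet> \<beta>) \<star> (\<alpha>' \<bullet> \<alpha>) = (\<beta>' \<star> \<alpha>') \<bullet> (\<beta> \<star> \<alpha>)"
    and hcmp_unit_right: "\<lbrakk>f \<in> hom K A B; \<alpha> \<in> cells K f f'\<rbrakk> \<Longrightarrow> \<alpha> \<star> idc K (ida K A) = \<alpha>"
    and hcmp_unit_left: "\<lbrakk>f \<in> hom K A B; \<alpha> \<in> cells K f f'\<rbrakk> \<Longrightarrow> idc K (ida K B) \<star> \<alpha> = \<alpha>"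
    and hcmp_assoc: "\<lbrakk>f \<in> hom K A B; \<alpha> \<in> cells K f f'; g \<in> hom K B C; \<beta> \<in> cells K g g';
        h \<in> hom K C D; \<gamma> \<in> cells K h h'\<rbrakk>
      \<Longrightarrow> (\<gamma> \<star> \<beta>) \<star> \<alpha> = \<gamma> \<star> (\<beta> \<star> \<alpha>)"

definition invertible_cell :: "('o, 'm, 'c) two_cat \<Rightarrow> 'm \<Rightarrow> 'm \<Rightarrow> 'c \<Rightarrow> bool" where
  "invertible_cell K f g \<alpha> \<longleftrightarrow> \<alpha> \<in> cells K f g \<and>
     (\<exists>\<beta> \<in> cells K g f. vcmp K \<beta> \<alpha> = idc K f \<and> vcmp K \<alpha> \<beta> = idc K g)"


section \<open>The 2-category of endo-2-functors\<close>

record ('o, 'm, 'c) endo =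
  fob :: "'o \<Rightarrow> 'o"
  far :: "'m \<Rightarrow> 'm"
  fce :: "'c \<Rightarrow> 'c"

definition id_endo :: "('o, 'm, 'c) endo" where
  "id_endo = \<lparr>fob = id, far = id, fce = id\<rparr>"

definition comp_endo :: "('o, 'm, 'c) endo \<Rightarrow> ('o, 'm, 'c) endo \<Rightarrow> ('o, 'm, 'c) endo" where
  "comp_endo G F = \<lparr>fob = fob G \<circ> fob F, far = far G \<circ> far F, fce = fce G \<circ> fce F\<rparr>"

definition two_functor :: "('o, 'm, 'c) two_cat \<Rightarrow> ('o, 'm, 'c) endo \<Rightarrow> bool" where
  "two_functor K F \<longleftrightarrow>
     (\<forall>A \<in> Obj K. fob F A \<in> Obj K) \<and>
     (\<forall>A B. \<forall>f \<in> hom K A B. far F f \<in> hom K (fob F A) (fob F B)) \<and>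
     (\<forall>f g. \<forall>\<alpha> \<in> cells K f g. fce F \<alpha> \<in> cells K (far F f) (far F g)) \<and>
     (\<forall>A \<in> Obj K. far F (ida K A) = ida K (fob F A)) \<and>
     (\<forall>A B C. \<forall>f \<in> hom K A B. \<forall>g \<in> hom K B C. far F (cmp K g f) = cmp K (far F g) (far F f)) \<and>
     (\<forall>f \<in> Arr K. fce F (idc K f) = idc K (far F f)) \<and>
     (\<forall>f g h. \<forall>\<alpha> \<in> cells K f g. \<forall>\<beta> \<in> cells K g h.
        fce F (vcmp K \<beta> \<alpha>) = vcmp K (fce F \<beta>) (fce F \<alpha>)) \<and>
     (\<forall>A B C. \<forall>f \<in> hom K A B. \<forall>g \<in> hom K B C. \<forall>f' g'. \<forall>\<alpha> \<in> cells K f f'. \<forall>\<beta> \<in> cells K g g'.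
        fce F (hcmp K \<beta> \<alpha>) = hcmp K (fce F \<beta>) (fce F \<alpha>))"

definition two_natural ::
  "('o, 'm, 'c) two_cat \<Rightarrow> ('o, 'm, 'c) endo \<Rightarrow> ('o, 'm, 'c) endo \<Rightarrow> ('o \<Rightarrow> 'm) \<Rightarrow> bool" where
  "two_natural K F G \<theta> \<longleftrightarrow>
     (\<forall>A \<in> Obj K. \<theta> A \<in> hom K (fob F A) (fob G A)) \<and>
     (\<forall>A B. \<forall>f \<in> hom K A B. cmp K (far G f) (\<theta> A) = cmp K (\<theta> B) (far F f)) \<and>
     (\<forall>A B. \<forall>f \<in> hom K A B. \<forall>g. \<forall>\<alpha> \<in> cells K f g.
        rwhisker K (fce G \<alpha>) (\<theta> A) = lwhisker K (\<theta> B) (fce F \<alpha>))"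

text \<open>Modification \<open>m : \<theta> \<rightarrow> \<phi>\<close> between 2-natural transformations \<open>F \<rightarrow> G\<close>.\<close>

definition modification ::
  "('o, 'm, 'c) two_cat \<Rightarrow> ('o, 'm, 'c) endo \<Rightarrow> ('o, 'm, 'c) endo
    \<Rightarrow> ('o \<Rightarrow> 'm) \<Rightarrow> ('o \<Rightarrow> 'm) \<Rightarrow> ('o \<Rightarrow> 'c) \<Rightarrow> bool" where
  "modification K F G \<theta> \<phi> m \<longleftrightarrow>
     (\<forall>A \<in> Obj K. m A \<in> cells K (\<theta> A) (\<phi> A)) \<and>
     (\<forall>A B. \<forall>f \<in> hom K A B. lwhisker K (far G f) (m A) = rwhisker K (m B) (far F f))"

text \<open>Adjunction \<open>l \<stileturn> r\<close> in the 2-category of endo-2-functors of \<open>K\<close>, 2-natural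
  transformations and modifications, where \<open>l : F \<rightarrow> G\<close> and \<open>r : G \<rightarrow> F\<close>.
  Identities and compositions in that 2-category are computed componentwise.\<close>

definition two_natural_adjoint ::
  "('o, 'm, 'c) two_cat \<Rightarrow> ('o, 'm, 'c) endo \<Rightarrow> ('o, 'm, 'c) endo
    \<Rightarrow> ('o \<Rightarrow> 'm) \<Rightarrow> ('o \<Rightarrow> 'm) \<Rightarrow> bool" where
  "two_natural_adjoint K F G l r \<longleftrightarrow>
     two_natural K F G l \<and> two_natural K G F r \<and>
     (\<exists>u e. modification K F F (\<lambda>A. ida K (fob F A)) (\<lambda>A. cmp K (r A) (l A)) u \<and>
        modification K G G (\<lambda>A. cmp K (l A) (r A)) (\<lambda>A. ida K (fob G A)) e \<and>
        (\<forall>A \<in> Obj K. vcmp K (rwhisker K (e A) (l A)) (lwhisker K (l A) (u A)) = idc K (l A)) \<and>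
        (\<forall>A \<in> Obj K. vcmp K (lwhisker K (r A) (e A)) (rwhisker K (u A) (r A)) = idc K (r A)))"


section \<open>2-monads, pseudo algebras and colax morphisms\<close>

locale two_monad = two_category K
  for K :: "('o, 'm, 'c) two_cat" (structure) +
  fixes T :: "('o, 'm, 'c) endo"
    and \<eta> :: "'o \<Rightarrow> 'm"
    and \<mu> :: "'o \<Rightarrow> 'm"
  assumes functor_T: "two_functor K T"
    and natural_eta: "two_natural K id_endo T \<eta>"
    and natural_mu: "two_natural K (comp_endo T T) T \<mu>"
    and mu_assoc: "A \<in> Obj K \<Longrightarrow> \<mu> A \<cdot> far T (\<mu> A) = \<mu> A \<cdot> \<mu> (fob T A)"
    and mu_T_eta: "A \<in> Obj K \<Longrightarrow> \<mu> A \<cdot> far T (\<eta> A) = ida K (fob T A)"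
    and mu_eta_T: "A \<in> Obj K \<Longrightarrow> \<mu> A \<cdot> \<eta> (fob T A) = ida K (fob T A)"

locale colax_idempotent_two_monad = two_monad +
  assumes eta_T_adjoint_mu: "two_natural_adjoint K T (comp_endo T T) (\<lambda>A. \<eta> (fob T A)) \<mu>"

definition pseudo_algebra ::
  "('o, 'm, 'c) two_cat \<Rightarrow> ('o, 'm, 'c) endo \<Rightarrow> ('o \<Rightarrow> 'm) \<Rightarrow> ('o \<Rightarrow> 'm)
    \<Rightarrow> 'o \<Rightarrow> 'm \<Rightarrow> 'c \<Rightarrow> 'c \<Rightarrow> bool" where
  "pseudo_algebra K T \<eta> \<mu> A a a0 a2 \<longleftrightarrow>
     A \<in> Obj K \<and> a \<in> hom K (fob T A) A \<and>
     invertible_cell K (ida K A) (cmp K a (\<eta> A)) a0 \<and>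
     invertible_cell K (cmp K a (far T a)) (cmp K a (\<mu> A)) a2 \<and>
     vcmp K (rwhisker K a2 (\<eta> (fob T A))) (rwhisker K a0 a) = idc K a \<and>
     vcmp K (rwhisker K a2 (far T (\<eta> A))) (lwhisker K a (fce T a0)) = idc K a \<and>
     vcmp K (rwhisker K a2 (\<mu> (fob T A))) (rwhisker K a2 (far T (far T a)))
       = vcmp K (rwhisker K a2 (far T (\<mu> A))) (lwhisker K a (fce T a2))"

definition colax_morphism ::
  "('o, 'm, 'c) two_cat \<Rightarrow> ('o, 'm, 'c) endo \<Rightarrow> ('o \<Rightarrow> 'm) \<Rightarrow> ('o \<Rightarrow> 'm)
    \<Rightarrow> 'o \<Rightarrow> 'm \<Rightarrow> 'c \<Rightarrow> 'c \<Rightarrow> 'o \<Rightarrow> 'm \<Rightarrow> 'c \<Rightarrow> 'c \<Rightarrow> 'm \<Rightarrow> 'c \<Rightarrow> bool" where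
  "colax_morphism K T \<eta> \<mu> A a a0 a2 B b b0 b2 f fbar \<longleftrightarrow>
     f \<in> hom K A B \<and> fbar \<in> cells K (cmp K f a) (cmp K b (far T f)) \<and>
     vcmp K (rwhisker K fbar (\<eta> A)) (lwhisker K f a0) = rwhisker K b0 f \<and>
     vcmp K (rwhisker K b2 (far T (far T f)))
         (vcmp K (lwhisker K b (fce T fbar)) (rwhisker K fbar (far T a)))
       = vcmp K (rwhisker K fbar (\<mu> A)) (lwhisker K f a2)"


section \<open>Comma objects, Kan extensions and exactness\<close>

text \<open>\<open>lax_square K P p q f g \<phi>\<close>: \<open>p : P \<rightarrow> A\<close>, \<open>q : P \<rightarrow> B\<close>, \<open>f : A \<rightarrow> C\<close>, \<open>g : B \<rightarrow> C\<close>
  and \<open>\<phi> : f p \<rightarrow> g q\<close>, for some objects \<open>A\<close>, \<open>B\<close>, \<open>C\<close>.\<close>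

definition lax_square ::
  "('o, 'm, 'c) two_cat \<Rightarrow> 'o \<Rightarrow> 'm \<Rightarrow> 'm \<Rightarrow> 'm \<Rightarrow> 'm \<Rightarrow> 'c \<Rightarrow> bool" where
  "lax_square K P p q f g \<phi> \<longleftrightarrow>
     (\<exists>A B C. p \<in> hom K P A \<and> q \<in> hom K P B \<and> f \<in> hom K A C \<and> g \<in> hom K B C \<and>
        \<phi> \<in> cells K (cmp K f p) (cmp K g q))"

text \<open>The universal property is the strict (2-categorical, not bicategorical) one, in
  dimension one (second conjunct) and in dimension two (third conjunct).\<close>

definition comma_square ::
  "('o, 'm, 'c) two_cat \<Rightarrow> 'o \<Rightarrow> 'm \<Rightarrow> 'm \<Rightarrow> 'm \<Rightarrow> 'm \<Rightarrow> 'c \<Rightarrow> bool" where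
  "comma_square K P p q f g lam \<longleftrightarrow>
     lax_square K P p q f g lam \<and>
     (\<forall>X x y \<phi>. lax_square K X x y f g \<phi> \<longrightarrow>
        (\<exists>!u. u \<in> hom K X P \<and> cmp K p u = x \<and> cmp K q u = y \<and> rwhisker K lam u = \<phi>)) \<and>
     (\<forall>X. \<forall>u \<in> hom K X P. \<forall>v \<in> hom K X P.
        \<forall>\<alpha> \<in> cells K (cmp K p u) (cmp K p v). \<forall>\<beta> \<in> cells K (cmp K q u) (cmp K q v).
          vcmp K (rwhisker K lam v) (lwhisker K f \<alpha>) = vcmp K (lwhisker K g \<beta>) (rwhisker K lam u) \<longrightarrow>
          (\<exists>!\<gamma>. \<gamma> \<in> cells K u v \<and> lwhisker K p \<gamma> = \<alpha> \<and> lwhisker K q \<gamma> = \<beta>))"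

definition has_comma_objects :: "('o, 'm, 'c) two_cat \<Rightarrow> bool" where
  "has_comma_objects K \<longleftrightarrow>
     (\<forall>A B C. \<forall>f \<in> hom K A C. \<forall>g \<in> hom K B C. \<exists>P p q lam. comma_square K P p q f g lam)"

text \<open>\<open>left_kan_extension K f g h \<psi>\<close>: the 2-cell \<open>\<psi> : g \<rightarrow> h f\<close> exhibits \<open>h\<close> as a left Kan
  extension of \<open>g\<close> along \<open>f\<close>.\<close>

definition left_kan_extension ::
  "('o, 'm, 'c) two_cat \<Rightarrow> 'm \<Rightarrow> 'm \<Rightarrow> 'm \<Rightarrow> 'c \<Rightarrow> bool" where
  "left_kan_extension K f g h \<psi> \<longleftrightarrow>
     (\<exists>X Y A. f \<in> hom K X Y \<and> g \<in> hom K X A \<and> h \<in> hom K Y A \<and> \<psi> \<in> cells K g (cmp K h f) \<and>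
        (\<forall>k \<in> hom K Y A.
           bij_betw (\<lambda>\<sigma>. vcmp K (rwhisker K \<sigma> f) \<psi>) (cells K h k) (cells K g (cmp K k f))))"

definition pointwise_left_kan_extension ::
  "('o, 'm, 'c) two_cat \<Rightarrow> 'm \<Rightarrow> 'm \<Rightarrow> 'm \<Rightarrow> 'c \<Rightarrow> bool" where
  "pointwise_left_kan_extension K f g h \<psi> \<longleftrightarrow>
     left_kan_extension K f g h \<psi> \<and>
     (\<forall>Z k P p q lam. k \<in> hom K Z (Tgt K f) \<and> comma_square K P p q f k lam \<longrightarrow>
        left_kan_extension K q (cmp K g p) (cmp K h k)
          (vcmp K (lwhisker K h lam) (rwhisker K \<psi> p)))"

definition exact_square ::
  "('o, 'm, 'c) two_cat \<Rightarrow> 'o \<Rightarrow> 'm \<Rightarrow> 'm \<Rightarrow> 'm \<Rightarrow> 'm \<Rightarrow> 'c \<Rightarrow> bool" where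
  "exact_square K P p q f g \<phi> \<longleftrightarrow>
     lax_square K P p q f g \<phi> \<and>
     (\<forall>h l \<psi>. pointwise_left_kan_extension K f h l \<psi> \<longrightarrow>
        pointwise_left_kan_extension K q (cmp K h p) (cmp K l g)
          (vcmp K (lwhisker K l \<phi>) (rwhisker K \<psi> p)))"

definition exact_colax_morphism ::
  "('o, 'm, 'c) two_cat \<Rightarrow> ('o, 'm, 'c) endo \<Rightarrow> 'o \<Rightarrow> 'm \<Rightarrow> 'm \<Rightarrow> 'm \<Rightarrow> 'c \<Rightarrow> bool" where
  "exact_colax_morphism K T A a b f fbar \<longleftrightarrow>
     exact_square K (fob T A) a (far T f) f b fbar"

end

theory Submission
  imports Defs
begin

text \<open>For a colax idempotent 2-monad the structure map of a pseudo algebra is right adjoint to the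
  unit, \<open>\<eta>\<^sub>A \<stileturn> a\<close> with unit \<open>a\<^sub>0\<close>, and the unit axiom forces the structure cell of a colax morphism to
  be the mate of \<open>T f \<cdot> \<eta>\<^sub>A = \<eta>\<^sub>B \<cdot> f\<close>. Such a mate square is exact in any 2-category: precomposition
  with a right adjoint is left adjoint to precomposition with its left adjoint, so
  \<open>[l b, k] \<cong> [l, k \<eta>\<^sub>B] \<cong> [h, k \<eta>\<^sub>B f] = [h, k T f \<eta>\<^sub>A] \<cong> [h a, k T f]\<close>. For pointwiseness, the
  comparison \<open>T f \<down> k \<rightarrow> f \<down> b k\<close> is itself a right adjoint over the domain of \<open>k\<close>, so that
  the same argument applies to the comma squares.\<close>

section \<open>Calculus of 1-cells and 2-cells in a strict 2-category\<close>

context two_category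
begin

lemma Arr_homI: "f \<in> Arr K \<Longrightarrow> f \<in> hom K (Src K f) (Tgt K f)"
  by (simp add: hom_def)

lemma Cell_cellsI: "\<alpha> \<in> Cell K \<Longrightarrow> \<alpha> \<in> cells K (Dom K \<alpha>) (Cod K \<alpha>)"
  by (simp add: cells_def)

lemma Dom_hom:
  "\<alpha> \<in> Cell K \<Longrightarrow> Dom K \<alpha> \<in> hom K (Src K (Dom K \<alpha>)) (Tgt K (Dom K \<alpha>))"
  by (simp add: hom_def Dom_in)

lemma ida_simps:
  assumes "A \<in> Obj K"
  shows "ida K A \<in> Arr K" "Src K (ida K A) = A" "Tgt K (ida K A) = A"
  using ida_hom[OF assms] by (auto simp: hom_def)

text \<open>The axioms of \<open>two_category\<close> carry object variables that do not occur in
  their conclusions, which makes them awkward as conditional rewrite rules. Here and in the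
  \<open>_simps\<close> lemmas below the premises become equations between sources and targets,
  which the simplifier can decide.\<close>

lemma cmp_simps:
  assumes "f \<in> Arr K" "g \<in> Arr K" "Src K g = Tgt K f"
  shows "g \<cdot> f \<in> Arr K" "Src K (g \<cdot> f) = Src K f" "Tgt K (g \<cdot> f) = Tgt K g"
  using cmp_hom[of f "Src K f" "Tgt K f" g "Tgt K g"] assms by (auto simp: hom_def)

lemma cmp_unit_simps:
  assumes "f \<in> Arr K"
  shows "Src K f = A \<Longrightarrow> f \<cdot> ida K A = f" "Tgt K f = B \<Longrightarrow> ida K B \<cdot> f = f"
  using cmp_ida_right cmp_ida_left Arr_homI[OF assms] by auto

lemma cmp_assoc_simp:
  "\<lbrakk>f \<in> Arr K; g \<in> Arr K; h \<in> Arr K; Src K g = Tgt K f; Src K h = Tgt K g\<rbrakk>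
    \<Longrightarrow> (h \<cdot> g) \<cdot> f = h \<cdot> (g \<cdot> f)"
  using cmp_assoc[of f "Src K f" "Tgt K f" g "Tgt K g" h "Tgt K h"] by (simp add: hom_def)

lemma idc_simps:
  assumes "f \<in> Arr K"
  shows "idc K f \<in> Cell K" "Dom K (idc K f) = f" "Cod K (idc K f) = f"
  using idc_cells[OF assms] by (auto simp: cells_def)

lemma vcmp_simps:
  assumes "\<alpha> \<in> Cell K" "\<beta> \<in> Cell K" "Dom K \<beta> = Cod K \<alpha>"
  shows "\<beta> \<bullet> \<alpha> \<in> Cell K" "Dom K (\<beta> \<bullet> \<alpha>) = Dom K \<alpha>" "Cod K (\<beta> \<bullet> \<alpha>) = Cod K \<beta>"
  using vcmp_cells[of \<alpha> "Dom K \<alpha>" "Cod K \<alpha>" \<beta> "Cod K \<beta>"] assms by (auto simp: cells_def)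

lemma vcmp_unit_simps:
  assumes "\<alpha> \<in> Cell K"
  shows "Dom K \<alpha> = f \<Longrightarrow> \<alpha> \<bullet> idc K f = \<alpha>" "Cod K \<alpha> = g \<Longrightarrow> idc K g \<bullet> \<alpha> = \<alpha>"
  using vcmp_idc_right vcmp_idc_left Cell_cellsI[OF assms] by auto

lemma vcmp_assoc_simp:
  "\<lbrakk>\<alpha> \<in> Cell K; \<beta> \<in> Cell K; \<gamma> \<in> Cell K; Dom K \<beta> = Cod K \<alpha>; Dom K \<gamma> = Cod K \<beta>\<rbrakk>
    \<Longrightarrow> (\<gamma> \<bullet> \<beta>) \<bullet> \<alpha> = \<gamma> \<bullet> (\<beta> \<bullet> \<alpha>)"
  using vcmp_assoc[of \<alpha> "Dom K \<alpha>" "Cod K \<alpha>" \<beta> "Cod K \<beta>" \<gamma> "Cod K \<gamma>"] by (simp add: cells_def)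

lemma hcmp_simps:
  assumes "\<alpha> \<in> Cell K" "\<beta> \<in> Cell K" "Src K (Dom K \<beta>) = Tgt K (Dom K \<alpha>)"
  shows "\<beta> \<star> \<alpha> \<in> Cell K" "Dom K (\<beta> \<star> \<alpha>) = Dom K \<beta> \<cdot> Dom K \<alpha>"
    "Cod K (\<beta> \<star> \<alpha>) = Cod K \<beta> \<cdot> Cod K \<alpha>"
  using hcmp_cells[OF Cell_cellsI Dom_hom Cell_cellsI, of \<alpha> \<beta>] Dom_hom[of \<beta>] assms
  by (auto simp: cells_def)

lemma hcmp_unit_simps:
  assumes "\<alpha> \<in> Cell K"
  shows "Src K (Dom K \<alpha>) = A \<Longrightarrow> \<alpha> \<star> idc K (ida K A) = \<alpha>"
    "Tgt K (Dom K \<alpha>) = B \<Longrightarrow> idc K (ida K B) \<star> \<alpha> = \<alpha>"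
  using hcmp_unit_right hcmp_unit_left Cell_cellsI[OF assms] Dom_hom[OF assms] by auto

lemma hcmp_assoc_simp:
  assumes "\<alpha> \<in> Cell K" "\<beta> \<in> Cell K" "\<gamma> \<in> Cell K"
    "Src K (Dom K \<beta>) = Tgt K (Dom K \<alpha>)" "Src K (Dom K \<gamma>) = Tgt K (Dom K \<beta>)"
  shows "(\<gamma> \<star> \<beta>) \<star> \<alpha> = \<gamma> \<star> (\<beta> \<star> \<alpha>)"
  using hcmp_assoc[OF Dom_hom Cell_cellsI _ Cell_cellsI _ Cell_cellsI, of \<alpha> \<beta> _ \<gamma>]
    Dom_hom[of \<beta>] Dom_hom[of \<gamma>] assms by simp

lemma idc_hcmp_simp:
  "\<lbrakk>f \<in> Arr K; g \<in> Arr K; Src K g = Tgt K f\<rbrakk> \<Longrightarrow> idc K g \<star> idc K f = idc K (g \<cdot> f)"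
  using hcmp_idc[of f "Src K f" "Tgt K f" g "Tgt K g"] by (simp add: hom_def)

text \<open>Associativity is used against the direction of \<open>hcmp_assoc_simp\<close> here, so
  that nested left whiskerings merge into one; the right-hand side is not split again.\<close>

lemma idc_hcmp_assoc_simp:
  assumes "f \<in> Arr K" "g \<in> Arr K" "\<alpha> \<in> Cell K" "Src K g = Tgt K f" "Src K f = Tgt K (Dom K \<alpha>)"
  shows "idc K g \<star> (idc K f \<star> \<alpha>) = idc K (g \<cdot> f) \<star> \<alpha>"
proof -
  have "idc K g \<star> (idc K f \<star> \<alpha>) = (idc K g \<star> idc K f) \<star> \<alpha>"
    using assms by (intro hcmp_assoc_simp[symmetric]) (simp_all add: idc_simps)
  then show ?thesis using assms by (simp add: idc_hcmp_simp)
qed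

lemma interchange_simp:
  assumes "\<alpha> \<in> Cell K" "\<alpha>' \<in> Cell K" "\<beta> \<in> Cell K" "\<beta>' \<in> Cell K"
    "Dom K \<alpha>' = Cod K \<alpha>" "Dom K \<beta>' = Cod K \<beta>" "Src K (Dom K \<beta>) = Tgt K (Dom K \<alpha>)"
  shows "(\<beta>' \<bullet> \<beta>) \<star> (\<alpha>' \<bullet> \<alpha>) = (\<beta>' \<star> \<alpha>') \<bullet> (\<beta> \<star> \<alpha>)"
  using interchange[of "Dom K \<alpha>" "Src K (Dom K \<alpha>)" "Tgt K (Dom K \<alpha>)" \<alpha> "Cod K \<alpha>" \<alpha>' "Cod K \<alpha>'"
      "Dom K \<beta>" "Tgt K (Dom K \<beta>)" \<beta> "Cod K \<beta>" \<beta>' "Cod K \<beta>'"]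
    assms Dom_hom[of \<alpha>] Dom_hom[of \<beta>] by (simp add: cells_def)

lemma lwhisker_vcmp:
  assumes "g \<in> Arr K" "\<alpha> \<in> Cell K" "\<beta> \<in> Cell K" "Dom K \<beta> = Cod K \<alpha>" "Src K g = Tgt K (Dom K \<alpha>)"
  shows "g \<rhd> (\<beta> \<bullet> \<alpha>) = (g \<rhd> \<beta>) \<bullet> (g \<rhd> \<alpha>)"
  using interchange_simp[of \<alpha> \<beta> "idc K g" "idc K g"] assms
  by (simp add: idc_simps vcmp_unit_simps)

lemma rwhisker_vcmp:
  assumes "f \<in> Arr K" "\<alpha> \<in> Cell K" "\<beta> \<in> Cell K" "Dom K \<beta> = Cod K \<alpha>" "Src K (Dom K \<alpha>) = Tgt K f"
  shows "(\<beta> \<bullet> \<alpha>) \<lhd> f = (\<beta> \<lhd> f) \<bullet> (\<alpha> \<lhd> f)"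
  using interchange_simp[of "idc K f" "idc K f" \<alpha> \<beta>] assms
  by (simp add: idc_simps vcmp_unit_simps)

text \<open>As rewrite rules these bring 2-cells into the form of vertical composites of cells
  \<open>G \<rhd> (\<alpha> \<lhd> F)\<close>, everything associated to the right.\<close>

lemmas pasting_simps =
  Src_in Tgt_in Dom_in Cod_in Src_parallel Tgt_parallel
  ida_simps cmp_simps cmp_unit_simps cmp_assoc_simp
  idc_simps vcmp_simps vcmp_unit_simps vcmp_assoc_simp
  hcmp_simps hcmp_unit_simps hcmp_assoc_simp idc_hcmp_simp idc_hcmp_assoc_simp
  lwhisker_vcmp rwhisker_vcmp

text \<open>Both sides equal \<open>\<beta> \<star> \<alpha>\<close>. This identity is kept out of
  the rewrite rules; every step called \<open>slide\<close> below is an instance of it.\<close>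

lemma whisker_exchange:
  assumes "\<alpha> \<in> Cell K" "\<beta> \<in> Cell K" "Src K (Dom K \<beta>) = Tgt K (Dom K \<alpha>)"
  shows "(\<beta> \<lhd> Cod K \<alpha>) \<bullet> (Dom K \<beta> \<rhd> \<alpha>) = (Cod K \<beta> \<rhd> \<alpha>) \<bullet> (\<beta> \<lhd> Dom K \<alpha>)"
  using interchange_simp[of \<alpha> "idc K (Cod K \<alpha>)" "idc K (Dom K \<beta>)" \<beta>]
    interchange_simp[of "idc K (Dom K \<alpha>)" \<alpha> \<beta> "idc K (Cod K \<beta>)"] assms
  by (simp add: pasting_simps)

section \<open>Adjunctions and transposition of 2-cells\<close>

definition adjunction :: "'o \<Rightarrow> 'o \<Rightarrow> 'm \<Rightarrow> 'm \<Rightarrow> 'c \<Rightarrow> 'c \<Rightarrow> bool" where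
  "adjunction X Y l r u e \<longleftrightarrow>
     l \<in> hom K X Y \<and> r \<in> hom K Y X \<and>
     u \<in> cells K (ida K X) (r \<cdot> l) \<and> e \<in> cells K (l \<cdot> r) (ida K Y) \<and>
     (e \<lhd> l) \<bullet> (l \<rhd> u) = idc K l \<and> (r \<rhd> e) \<bullet> (u \<lhd> r) = idc K r"

lemma adjunctionD:
  assumes "adjunction X Y l r u e"
  shows "X \<in> Obj K" "Y \<in> Obj K"
    "l \<in> Arr K" "Src K l = X" "Tgt K l = Y" "r \<in> Arr K" "Src K r = Y" "Tgt K r = X"
    "u \<in> Cell K" "Dom K u = ida K X" "Cod K u = r \<cdot> l"
    "e \<in> Cell K" "Dom K e = l \<cdot> r" "Cod K e = ida K Y"
  using assms Src_in[of l] Tgt_in[of l] unfolding adjunction_def hom_def cells_def by auto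

lemma adjunction_triangles:
  assumes "adjunction X Y l r u e"
  shows "(e \<lhd> l) \<bullet> (l \<rhd> u) = idc K l" "(r \<rhd> e) \<bullet> (u \<lhd> r) = idc K r"
  using assms unfolding adjunction_def by auto

text \<open>Serves as the adjunction on the domain of \<open>k\<close>, which stays fixed when comma
  squares are compared.\<close>

lemma adjunction_id:
  assumes "X \<in> Obj K"
  shows "adjunction X X (ida K X) (ida K X) (idc K (ida K X)) (idc K (ida K X))"
  using assms by (simp add: adjunction_def hom_def cells_def pasting_simps)

context
  fixes X Y l r u e
  assumes adj: "adjunction X Y l r u e"
begin

lemmas adj_simps = adjunctionD[OF adj]

text \<open>Slide \<open>e\<close> past \<open>\<sigma>\<close>; what remains is the second triangle
  identity whiskered by \<open>x\<close>. Besides giving half of a bijection, it later recovers the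
  structure cell of a colax morphism from its unit axiom.\<close>

lemma transpose_inverse_left:
  assumes "x \<in> hom K X A" "y \<in> hom K Y A" "\<sigma> \<in> cells K (x \<cdot> r) y"
  shows "(y \<rhd> e) \<bullet> (((\<sigma> \<lhd> l) \<bullet> (x \<rhd> u)) \<lhd> r) = \<sigma>"
proof -
  note [simp] = pasting_simps adj_simps
  have [simp]: "x \<in> Arr K" "Src K x = X" "y \<in> Arr K" "Src K y = Y"
    "\<sigma> \<in> Cell K" "Dom K \<sigma> = x \<cdot> r" "Cod K \<sigma> = y"
    using assms by (auto simp: hom_def cells_def)
  have slide: "(y \<rhd> e) \<bullet> (\<sigma> \<lhd> (l \<cdot> r)) = \<sigma> \<bullet> ((x \<cdot> r) \<rhd> e)"
    using whisker_exchange[of e \<sigma>] by simp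
  have triangle: "((x \<cdot> r) \<rhd> e) \<bullet> (x \<rhd> (u \<lhd> r)) = idc K (x \<cdot> r)"
    using arg_cong[OF adjunction_triangles(2)[OF adj], of "\<lambda>z. x \<rhd> z"] by simp
  have "(y \<rhd> e) \<bullet> (((\<sigma> \<lhd> l) \<bullet> (x \<rhd> u)) \<lhd> r)
      = ((y \<rhd> e) \<bullet> (\<sigma> \<lhd> (l \<cdot> r))) \<bullet> (x \<rhd> (u \<lhd> r))" by simp
  also have "\<dots> = \<sigma> \<bullet> (((x \<cdot> r) \<rhd> e) \<bullet> (x \<rhd> (u \<lhd> r)))" by (simp add: slide)
  also have "\<dots> = \<sigma>" by (simp add: triangle)
  finally show ?thesis .
qed

lemma transpose_inverse_right:
  assumes "x \<in> hom K X A" "y \<in> hom K Y A" "\<rho> \<in> cells K x (y \<cdot> l)"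
  shows "(((y \<rhd> e) \<bullet> (\<rho> \<lhd> r)) \<lhd> l) \<bullet> (x \<rhd> u) = \<rho>"
proof -
  note [simp] = pasting_simps adj_simps
  have [simp]: "x \<in> Arr K" "Src K x = X" "y \<in> Arr K" "Src K y = Y"
    "\<rho> \<in> Cell K" "Dom K \<rho> = x" "Cod K \<rho> = y \<cdot> l"
    using assms by (auto simp: hom_def cells_def)
  have slide: "(\<rho> \<lhd> (r \<cdot> l)) \<bullet> (x \<rhd> u) = ((y \<cdot> l) \<rhd> u) \<bullet> \<rho>"
    using whisker_exchange[of u \<rho>] by simp
  have triangle: "(y \<rhd> (e \<lhd> l)) \<bullet> ((y \<cdot> l) \<rhd> u) = idc K (y \<cdot> l)"
    using arg_cong[OF adjunction_triangles(1)[OF adj], of "\<lambda>z. y \<rhd> z"] by simp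
  have "(((y \<rhd> e) \<bullet> (\<rho> \<lhd> r)) \<lhd> l) \<bullet> (x \<rhd> u)
      = (y \<rhd> (e \<lhd> l)) \<bullet> ((\<rho> \<lhd> (r \<cdot> l)) \<bullet> (x \<rhd> u))" by simp
  also have "\<dots> = ((y \<rhd> (e \<lhd> l)) \<bullet> ((y \<cdot> l) \<rhd> u)) \<bullet> \<rho>" unfolding slide by simp
  also have "\<dots> = \<rho>" by (simp add: triangle)
  finally show ?thesis .
qed

text \<open>Precomposition with \<open>r\<close> is left adjoint to precomposition with
  \<open>l\<close>. Both directions are recorded because the next result uses one for each of its
  two adjunctions.\<close>

lemma transpose_bij:
  assumes x: "x \<in> hom K X A" and y: "y \<in> hom K Y A"
  shows "bij_betw (\<lambda>\<sigma>. (\<sigma> \<lhd> l) \<bullet> (x \<rhd> u)) (cells K (x \<cdot> r) y) (cells K x (y \<cdot> l))"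
    and "bij_betw (\<lambda>\<rho>. (y \<rhd> e) \<bullet> (\<rho> \<lhd> r)) (cells K x (y \<cdot> l)) (cells K (x \<cdot> r) y)"
proof -
  note [simp] = pasting_simps adj_simps
  have [simp]: "x \<in> Arr K" "Src K x = X" "y \<in> Arr K" "Src K y = Y"
    using assms by (auto simp: hom_def)
  have 1: "(\<sigma> \<lhd> l) \<bullet> (x \<rhd> u) \<in> cells K x (y \<cdot> l)" if "\<sigma> \<in> cells K (x \<cdot> r) y" for \<sigma>
    using that by (auto simp: cells_def)
  have 2: "(y \<rhd> e) \<bullet> (\<rho> \<lhd> r) \<in> cells K (x \<cdot> r) y" if "\<rho> \<in> cells K x (y \<cdot> l)" for \<rho>
    using that by (auto simp: cells_def)
  show "bij_betw (\<lambda>\<sigma>. (\<sigma> \<lhd> l) \<bullet> (x \<rhd> u)) (cells K (x \<cdot> r) y) (cells K x (y \<cdot> l))"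
    by (rule bij_betw_byWitness[where f' = "\<lambda>\<rho>. (y \<rhd> e) \<bullet> (\<rho> \<lhd> r)"])
      (use transpose_inverse_left[OF x y] transpose_inverse_right[OF x y] 1 2 in auto)
  show "bij_betw (\<lambda>\<rho>. (y \<rhd> e) \<bullet> (\<rho> \<lhd> r)) (cells K x (y \<cdot> l)) (cells K (x \<cdot> r) y)"
    by (rule bij_betw_byWitness[where f' = "\<lambda>\<sigma>. (\<sigma> \<lhd> l) \<bullet> (x \<rhd> u)"])
      (use transpose_inverse_left[OF x y] transpose_inverse_right[OF x y] 1 2 in auto)
qed

end

section \<open>Left Kan extensions and mates\<close>

text \<open>The bijections \<open>[h v', k] \<cong> [h, k w'] \<cong> [g, k w' q'] = [g, k q w]
  \<cong> [g v, k q]\<close> compose to the required universal property. The lemma serves twice: for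
  the given square and for the comparison of comma squares.\<close>

lemma left_kan_extension_mate:
  assumes adj: "adjunction X Y w v u e" and adj': "adjunction X' Y' w' v' u' e'"
    and q: "q \<in> hom K Y Y'" and sq: "q \<cdot> w = w' \<cdot> q'"
    and kan: "left_kan_extension K q' g h \<psi>" and q': "q' \<in> hom K X X'"
  shows "left_kan_extension K q (g \<cdot> v) (h \<cdot> v')
    ((h \<rhd> (((v' \<cdot> q) \<rhd> e) \<bullet> (u' \<lhd> (q' \<cdot> v)))) \<bullet> (\<psi> \<lhd> v))"
    (is "left_kan_extension K q _ _ ?\<phi>")
proof -
  note [simp] = pasting_simps adjunctionD[OF adj] adjunctionD[OF adj']
  obtain A where g: "g \<in> hom K X A" and h: "h \<in> hom K X' A"
    and \<psi>: "\<psi> \<in> cells K g (h \<cdot> q')"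
    and bij: "\<And>k. k \<in> hom K X' A \<Longrightarrow>
      bij_betw (\<lambda>\<sigma>. (\<sigma> \<lhd> q') \<bullet> \<psi>) (cells K h k) (cells K g (k \<cdot> q'))"
    using kan q' unfolding left_kan_extension_def by (auto simp: hom_def)
  have [simp]: "q \<in> Arr K" "Src K q = Y" "Tgt K q = Y'" "q' \<in> Arr K" "Src K q' = X" "Tgt K q' = X'"
    "g \<in> Arr K" "Src K g = X" "Tgt K g = A" "h \<in> Arr K" "Src K h = X'" "Tgt K h = A"
    "\<psi> \<in> Cell K" "Dom K \<psi> = g" "Cod K \<psi> = h \<cdot> q'"
    using q q' g h \<psi> by (auto simp: hom_def cells_def)
  \<comment> \<open>Composites are normalised to the right, so \<open>sq\<close> alone would miss
    \<open>q \<cdot> (w \<cdot> x)\<close>.\<close>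
  have sq': "q \<cdot> (w \<cdot> x) = w' \<cdot> (q' \<cdot> x)" if "x \<in> Arr K" "Tgt K x = X" for x
    using arg_cong[OF sq, of "\<lambda>z. z \<cdot> x"] that by simp
  note [simp] = sq sq'
  have "bij_betw (\<lambda>\<sigma>. (\<sigma> \<lhd> q) \<bullet> ?\<phi>) (cells K (h \<cdot> v') k) (cells K (g \<cdot> v) (k \<cdot> q))"
    if k: "k \<in> hom K Y' A" for k
  proof -
    have [simp]: "k \<in> Arr K" "Src K k = Y'" "Tgt K k = A" using k by (auto simp: hom_def)
    \<comment> \<open>The left side is the composite of the three bijections below, so that
      composite is pasting with \<open>?\<phi>\<close>.\<close>
    have eq: "((k \<cdot> q) \<rhd> e) \<bullet> (((((\<sigma> \<lhd> w') \<bullet> (h \<rhd> u')) \<lhd> q') \<bullet> \<psi>) \<lhd> v) = (\<sigma> \<lhd> q) \<bullet> ?\<phi>"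
      if "\<sigma> \<in> cells K (h \<cdot> v') k" for \<sigma>
    proof -
      have [simp]: "\<sigma> \<in> Cell K" "Dom K \<sigma> = h \<cdot> v'" "Cod K \<sigma> = k"
        using that by (auto simp: cells_def)
      have slide: "((k \<cdot> q) \<rhd> e) \<bullet> (\<sigma> \<lhd> (w' \<cdot> q' \<cdot> v)) = (\<sigma> \<lhd> q) \<bullet> ((h \<cdot> v' \<cdot> q) \<rhd> e)"
        using whisker_exchange[of "q \<rhd> e" \<sigma>] by simp
      have "((k \<cdot> q) \<rhd> e) \<bullet> (((((\<sigma> \<lhd> w') \<bullet> (h \<rhd> u')) \<lhd> q') \<bullet> \<psi>) \<lhd> v)
          = (((k \<cdot> q) \<rhd> e) \<bullet> (\<sigma> \<lhd> (w' \<cdot> q' \<cdot> v))) \<bullet> (h \<rhd> (u' \<lhd> (q' \<cdot> v))) \<bullet> (\<psi> \<lhd> v)" by simp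
      also have "\<dots> = (\<sigma> \<lhd> q) \<bullet> ?\<phi>" unfolding slide by simp
      finally show ?thesis .
    qed
    have 1: "bij_betw (\<lambda>\<sigma>. (\<sigma> \<lhd> w') \<bullet> (h \<rhd> u')) (cells K (h \<cdot> v') k) (cells K h (k \<cdot> w'))"
      by (rule transpose_bij(1)[OF adj' h k])
    have 2: "bij_betw (\<lambda>\<sigma>. (\<sigma> \<lhd> q') \<bullet> \<psi>) (cells K h (k \<cdot> w')) (cells K g ((k \<cdot> q) \<cdot> w))"
      using bij[of "k \<cdot> w'"] by (simp add: hom_def)
    have 3: "bij_betw (\<lambda>\<rho>. ((k \<cdot> q) \<rhd> e) \<bullet> (\<rho> \<lhd> v)) (cells K g ((k \<cdot> q) \<cdot> w)) (cells K (g \<cdot> v) (k \<cdot> q))"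
      by (rule transpose_bij(2)[OF adj g]) (simp add: hom_def)
    show ?thesis
      using bij_betw_trans[OF bij_betw_trans[OF 1 2] 3] eq
      by (subst bij_betw_cong[symmetric]) (auto simp: o_def)
  qed
  moreover have "?\<phi> \<in> cells K (g \<cdot> v) ((h \<cdot> v') \<cdot> q)" by (simp add: cells_def)
  ultimately show ?thesis
    unfolding left_kan_extension_def by (intro exI[of _ Y] exI[of _ Y'] exI[of _ A]) (simp add: hom_def)
qed

text \<open>The compatibilities of the mate \<open>\<phi>\<close> with the units and with the
  counits. They are what allows 2-cells to be lifted to comma objects below.\<close>

lemma mate_eqs:
  assumes adj: "adjunction A A' i a u e" and adj': "adjunction B B' j b u' e'"
    and f: "f \<in> hom K A B" and g: "g \<in> hom K A' B'" and sq: "g \<cdot> i = j \<cdot> f"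
    and \<phi>: "\<phi> = ((b \<cdot> g) \<rhd> e) \<bullet> (u' \<lhd> (f \<cdot> a))"
  shows "\<phi> \<in> cells K (f \<cdot> a) (b \<cdot> g)"
    and "(\<phi> \<lhd> i) \<bullet> (f \<rhd> u) = u' \<lhd> f"
    and "(e' \<lhd> g) \<bullet> (j \<rhd> \<phi>) = g \<rhd> e"
proof -
  note [simp] = pasting_simps adjunctionD[OF adj] adjunctionD[OF adj']
  have [simp]: "f \<in> Arr K" "Src K f = A" "Tgt K f = B" "g \<in> Arr K" "Src K g = A'" "Tgt K g = B'"
    using f g by (auto simp: hom_def)
  have sq': "g \<cdot> (i \<cdot> x) = j \<cdot> (f \<cdot> x)" if "x \<in> Arr K" "Tgt K x = A" for x
    using arg_cong[OF sq, of "\<lambda>z. z \<cdot> x"] that by simp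
  note [simp] = sq sq'
  show "\<phi> \<in> cells K (f \<cdot> a) (b \<cdot> g)" by (simp add: \<phi> cells_def)
  \<comment> \<open>By \<open>sq\<close> the target \<open>b j f\<close> of
    \<open>u' \<lhd> f\<close> is \<open>b g i\<close>, and \<open>\<phi>\<close> is the transpose
    of this cell along \<open>i \<stileturn> a\<close>.\<close>
  have "f \<in> hom K A B" "b \<cdot> g \<in> hom K A' B" "u' \<lhd> f \<in> cells K f ((b \<cdot> g) \<cdot> i)"
    by (simp_all add: hom_def cells_def)
  from transpose_inverse_right[OF adj this] show "(\<phi> \<lhd> i) \<bullet> (f \<rhd> u) = u' \<lhd> f"
    by (simp add: \<phi>)
  have slide: "(e' \<lhd> g) \<bullet> ((j \<cdot> b \<cdot> g) \<rhd> e) = (g \<rhd> e) \<bullet> (e' \<lhd> (j \<cdot> f \<cdot> a))"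
    using whisker_exchange[of "g \<rhd> e" e'] by simp
  have triangle: "(e' \<lhd> (j \<cdot> f \<cdot> a)) \<bullet> (j \<rhd> (u' \<lhd> (f \<cdot> a))) = idc K (j \<cdot> f \<cdot> a)"
    using arg_cong[OF adjunction_triangles(1)[OF adj'], of "\<lambda>z. z \<lhd> (f \<cdot> a)"] by simp
  have "(e' \<lhd> g) \<bullet> (j \<rhd> \<phi>)
      = ((e' \<lhd> g) \<bullet> ((j \<cdot> b \<cdot> g) \<rhd> e)) \<bullet> (j \<rhd> (u' \<lhd> (f \<cdot> a)))" by (simp add: \<phi>)
  also have "\<dots> = (g \<rhd> e) \<bullet> ((e' \<lhd> (j \<cdot> f \<cdot> a)) \<bullet> (j \<rhd> (u' \<lhd> (f \<cdot> a))))"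
    unfolding slide by simp
  also have "\<dots> = g \<rhd> e" by (simp add: triangle)
  finally show "(e' \<lhd> g) \<bullet> (j \<rhd> \<phi>) = g \<rhd> e" .
qed

section \<open>Comma objects and the comparison between them\<close>

text \<open>Joint faithfulness of the projections on 2-cells: the projections of an existing
  \<open>\<gamma>\<close> satisfy the compatibility condition by interchange, so the uniqueness in
  the two-dimensional universal property applies.\<close>

lemma comma_square_cells_eq:
  assumes comma: "comma_square K P p q f g lam"
    and uv: "u \<in> hom K X P" "v \<in> hom K X P"
    and \<gamma>: "\<gamma> \<in> cells K u v" "\<delta> \<in> cells K u v"
    and eq: "p \<rhd> \<gamma> = p \<rhd> \<delta>" "q \<rhd> \<gamma> = q \<rhd> \<delta>"
  shows "\<gamma> = \<delta>"
proof -
  note [simp] = pasting_simps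
  from comma obtain A B C where "p \<in> hom K P A" "q \<in> hom K P B" "f \<in> hom K A C" "g \<in> hom K B C"
    "lam \<in> cells K (f \<cdot> p) (g \<cdot> q)"
    unfolding comma_square_def lax_square_def by auto
  then have [simp]: "p \<in> Arr K" "Src K p = P" "Tgt K p = A" "q \<in> Arr K" "Src K q = P" "Tgt K q = B"
    "f \<in> Arr K" "Src K f = A" "Tgt K f = C" "g \<in> Arr K" "Src K g = B" "Tgt K g = C"
    "lam \<in> Cell K" "Dom K lam = f \<cdot> p" "Cod K lam = g \<cdot> q"
    by (auto simp: hom_def cells_def)
  have [simp]: "u \<in> Arr K" "Src K u = X" "Tgt K u = P" "v \<in> Arr K" "Src K v = X" "Tgt K v = P"
    "\<gamma> \<in> Cell K" "Dom K \<gamma> = u" "Cod K \<gamma> = v"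
    using uv \<gamma> by (auto simp: hom_def cells_def)
  have "p \<rhd> \<gamma> \<in> cells K (p \<cdot> u) (p \<cdot> v)" "q \<rhd> \<gamma> \<in> cells K (q \<cdot> u) (q \<cdot> v)"
    by (simp_all add: cells_def)
  moreover have "(lam \<lhd> v) \<bullet> (f \<rhd> (p \<rhd> \<gamma>)) = (g \<rhd> (q \<rhd> \<gamma>)) \<bullet> (lam \<lhd> u)"
    using whisker_exchange[of \<gamma> lam] by simp
  ultimately have "\<exists>!\<zeta>. \<zeta> \<in> cells K u v \<and> p \<rhd> \<zeta> = p \<rhd> \<gamma> \<and> q \<rhd> \<zeta> = q \<rhd> \<gamma>"
    using comma uv unfolding comma_square_def by blast
  then show ?thesis using \<gamma> eq by metis
qed

text \<open>The one-dimensional universal properties give \<open>v\<close> and \<open>w\<close>, the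
  two-dimensional ones lift \<open>u\<close> and \<open>e\<close> to a unit and a counit. Everything
  lies over the identity of \<open>Z\<close>, whence \<open>q \<rhd> E = idc K q\<close>.\<close>

lemma comma_adjunction:
  assumes adj: "adjunction A A' i a u e" and adj': "adjunction B B' j b u' e'"
    and f: "f \<in> hom K A B" and g: "g \<in> hom K A' B'" and sq: "g \<cdot> i = j \<cdot> f"
    and \<phi>: "\<phi> = ((b \<cdot> g) \<rhd> e) \<bullet> (u' \<lhd> (f \<cdot> a))"
    and k: "k \<in> hom K Z B'"
    and comma: "comma_square K P p q g k lam"
    and comma': "comma_square K P' p' q' f (b \<cdot> k) lam'"
  obtains v w U E where "adjunction P' P w v U E" "p' \<cdot> v = a \<cdot> p" "q' \<cdot> v = q" "q \<cdot> w = q'"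
    "lam' \<lhd> v = (b \<rhd> lam) \<bullet> (\<phi> \<lhd> p)" "q \<rhd> E = idc K q"
proof -
  note [simp] = pasting_simps adjunctionD[OF adj] adjunctionD[OF adj']
  have [simp]: "f \<in> Arr K" "Src K f = A" "Tgt K f = B" "g \<in> Arr K" "Src K g = A'" "Tgt K g = B'"
    "k \<in> Arr K" "Src K k = Z" "Tgt K k = B'"
    using f g k by (auto simp: hom_def)
  have sq': "g \<cdot> (i \<cdot> x) = j \<cdot> (f \<cdot> x)" if "x \<in> Arr K" "Tgt K x = A" for x
    using arg_cong[OF sq, of "\<lambda>z. z \<cdot> x"] that by simp
  note [simp] = sq sq'
  note mate = mate_eqs[OF adj adj' f g sq \<phi>]
  have [simp]: "\<phi> \<in> Cell K" "Dom K \<phi> = f \<cdot> a" "Cod K \<phi> = b \<cdot> g"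
    using mate(1) by (auto simp: cells_def)
  have [simp]: "p \<in> Arr K" "Src K p = P" "Tgt K p = A'" "q \<in> Arr K" "Src K q = P" "Tgt K q = Z"
    "lam \<in> Cell K" "Dom K lam = g \<cdot> p" "Cod K lam = k \<cdot> q"
    "p' \<in> Arr K" "Src K p' = P'" "Tgt K p' = A" "q' \<in> Arr K" "Src K q' = P'" "Tgt K q' = Z"
    "lam' \<in> Cell K" "Dom K lam' = f \<cdot> p'" "Cod K lam' = b \<cdot> k \<cdot> q'"
    using comma comma' unfolding comma_square_def lax_square_def by (auto simp: hom_def cells_def)
  have [simp]: "P \<in> Obj K" "P' \<in> Obj K" using Src_in[of p] Src_in[of p'] by simp_all
  \<comment> \<open>The right adjoint \<open>v\<close> classifies \<open>lam\<close> pasted with the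
    mate square.\<close>
  have "lax_square K P (a \<cdot> p) q f (b \<cdot> k) ((b \<rhd> lam) \<bullet> (\<phi> \<lhd> p))"
    unfolding lax_square_def
    by (intro exI[of _ A] exI[of _ Z] exI[of _ B]) (simp add: hom_def cells_def)
  then obtain v where v: "v \<in> hom K P P'" and pv: "p' \<cdot> v = a \<cdot> p" and qv: "q' \<cdot> v = q"
    and lamv: "lam' \<lhd> v = (b \<rhd> lam) \<bullet> (\<phi> \<lhd> p)"
    using comma' unfolding comma_square_def by blast
  \<comment> \<open>The left adjoint \<open>w\<close> classifies the transpose of
    \<open>lam'\<close> under \<open>j \<stileturn> b\<close>, whose source \<open>j f p'\<close> is
    \<open>g i p'\<close>.\<close>
  have "lax_square K P' (i \<cdot> p') q' g k ((e' \<lhd> (k \<cdot> q')) \<bullet> (j \<rhd> lam'))"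
    unfolding lax_square_def
    by (intro exI[of _ A'] exI[of _ Z] exI[of _ B']) (simp add: hom_def cells_def)
  then obtain w where w: "w \<in> hom K P' P" and pw: "p \<cdot> w = i \<cdot> p'" and qw: "q \<cdot> w = q'"
    and lamw: "lam \<lhd> w = (e' \<lhd> (k \<cdot> q')) \<bullet> (j \<rhd> lam')"
    using comma unfolding comma_square_def by blast
  have [simp]: "v \<in> Arr K" "Src K v = P" "Tgt K v = P'" "w \<in> Arr K" "Src K w = P'" "Tgt K w = P"
    using v w by (auto simp: hom_def)
  have pqv: "p' \<cdot> (v \<cdot> x) = a \<cdot> (p \<cdot> x)" "q' \<cdot> (v \<cdot> x) = q \<cdot> x" if "x \<in> Arr K" "Tgt K x = P" for x
    using arg_cong[OF pv, of "\<lambda>z. z \<cdot> x"] arg_cong[OF qv, of "\<lambda>z. z \<cdot> x"] that by simp_all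
  have pqw: "p \<cdot> (w \<cdot> x) = i \<cdot> (p' \<cdot> x)" "q \<cdot> (w \<cdot> x) = q' \<cdot> x" if "x \<in> Arr K" "Tgt K x = P'" for x
    using arg_cong[OF pw, of "\<lambda>z. z \<cdot> x"] arg_cong[OF qw, of "\<lambda>z. z \<cdot> x"] that by simp_all
  note [simp] = pv qv pw qw pqv pqw
  \<comment> \<open>Compatibility with \<open>lam\<close> reduces to the counit equation
    \<open>mate(3)\<close>.\<close>
  have "\<exists>!E. E \<in> cells K (w \<cdot> v) (ida K P) \<and> p \<rhd> E = e \<lhd> p \<and> q \<rhd> E = idc K q"
  proof -
    have slide: "(e' \<lhd> (k \<cdot> q)) \<bullet> ((j \<cdot> b) \<rhd> lam) = lam \<bullet> (e' \<lhd> (g \<cdot> p))"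
      using whisker_exchange[of lam e'] by simp
    have m: "(e' \<lhd> (g \<cdot> p)) \<bullet> (j \<rhd> (\<phi> \<lhd> p)) = g \<rhd> (e \<lhd> p)"
      using arg_cong[OF mate(3), of "\<lambda>z. z \<lhd> p"] by simp
    have "lam \<lhd> (w \<cdot> v) = (lam \<lhd> w) \<lhd> v" by simp
    also have "\<dots> = (e' \<lhd> (k \<cdot> q)) \<bullet> (j \<rhd> (lam' \<lhd> v))" unfolding lamw by simp
    also have "\<dots> = ((e' \<lhd> (k \<cdot> q)) \<bullet> ((j \<cdot> b) \<rhd> lam)) \<bullet> (j \<rhd> (\<phi> \<lhd> p))" unfolding lamv by simp
    also have "\<dots> = lam \<bullet> ((e' \<lhd> (g \<cdot> p)) \<bullet> (j \<rhd> (\<phi> \<lhd> p)))" unfolding slide by simp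
    also have "\<dots> = lam \<bullet> (g \<rhd> (e \<lhd> p))" unfolding m ..
    finally have "(lam \<lhd> ida K P) \<bullet> (g \<rhd> (e \<lhd> p)) = (k \<rhd> idc K q) \<bullet> (lam \<lhd> (w \<cdot> v))" by simp
    moreover have "e \<lhd> p \<in> cells K (p \<cdot> (w \<cdot> v)) (p \<cdot> ida K P)"
      "idc K q \<in> cells K (q \<cdot> (w \<cdot> v)) (q \<cdot> ida K P)"
      "w \<cdot> v \<in> hom K P P" "ida K P \<in> hom K P P"
      by (simp_all add: cells_def hom_def)
    ultimately show ?thesis using comma unfolding comma_square_def by blast
  qed
  then obtain E where E: "E \<in> cells K (w \<cdot> v) (ida K P)" and pE: "p \<rhd> E = e \<lhd> p" and qE: "q \<rhd> E = idc K q"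
    by blast
  \<comment> \<open>Compatibility with \<open>lam'\<close> reduces to the unit equation
    \<open>mate(2)\<close> and a triangle identity of \<open>j \<stileturn> b\<close>.\<close>
  have "\<exists>!U. U \<in> cells K (ida K P') (v \<cdot> w) \<and> p' \<rhd> U = u \<lhd> p' \<and> q' \<rhd> U = idc K q'"
  proof -
    have m: "(\<phi> \<lhd> (i \<cdot> p')) \<bullet> (f \<rhd> (u \<lhd> p')) = u' \<lhd> (f \<cdot> p')"
      using arg_cong[OF mate(2), of "\<lambda>z. z \<lhd> p'"] by simp
    have slide: "((b \<cdot> j) \<rhd> lam') \<bullet> (u' \<lhd> (f \<cdot> p')) = (u' \<lhd> (b \<cdot> k \<cdot> q')) \<bullet> lam'"
      using whisker_exchange[of lam' u'] by simp
    have triangle: "(b \<rhd> (e' \<lhd> (k \<cdot> q'))) \<bullet> (u' \<lhd> (b \<cdot> k \<cdot> q')) = idc K (b \<cdot> k \<cdot> q')"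
      using arg_cong[OF adjunction_triangles(2)[OF adj'], of "\<lambda>z. z \<lhd> (k \<cdot> q')"] by simp
    have "(lam' \<lhd> (v \<cdot> w)) \<bullet> (f \<rhd> (u \<lhd> p')) = ((lam' \<lhd> v) \<lhd> w) \<bullet> (f \<rhd> (u \<lhd> p'))" by simp
    also have "\<dots> = (b \<rhd> (lam \<lhd> w)) \<bullet> (\<phi> \<lhd> (i \<cdot> p')) \<bullet> (f \<rhd> (u \<lhd> p'))" unfolding lamv by simp
    also have "\<dots> = (b \<rhd> (e' \<lhd> (k \<cdot> q'))) \<bullet> ((b \<cdot> j) \<rhd> lam') \<bullet> (u' \<lhd> (f \<cdot> p'))"
      unfolding lamw m by simp
    also have "\<dots> = ((b \<rhd> (e' \<lhd> (k \<cdot> q'))) \<bullet> (u' \<lhd> (b \<cdot> k \<cdot> q'))) \<bullet> lam'" unfolding slide by simp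
    also have "\<dots> = lam'" unfolding triangle by simp
    finally have "(lam' \<lhd> (v \<cdot> w)) \<bullet> (f \<rhd> (u \<lhd> p')) = ((b \<cdot> k) \<rhd> idc K q') \<bullet> (lam' \<lhd> ida K P')" by simp
    moreover have "u \<lhd> p' \<in> cells K (p' \<cdot> ida K P') (p' \<cdot> (v \<cdot> w))"
      "idc K q' \<in> cells K (q' \<cdot> ida K P') (q' \<cdot> (v \<cdot> w))"
      "v \<cdot> w \<in> hom K P' P'" "ida K P' \<in> hom K P' P'"
      by (simp_all add: cells_def hom_def)
    ultimately show ?thesis using comma' unfolding comma_square_def by blast
  qed
  then obtain U where U: "U \<in> cells K (ida K P') (v \<cdot> w)" and pU: "p' \<rhd> U = u \<lhd> p'" and qU: "q' \<rhd> U = idc K q'"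
    by blast
  have [simp]: "E \<in> Cell K" "Dom K E = w \<cdot> v" "Cod K E = ida K P"
    "U \<in> Cell K" "Dom K U = ida K P'" "Cod K U = v \<cdot> w"
    using E U by (auto simp: cells_def)
  have whisker [simp]: "p \<rhd> (E \<lhd> x) = e \<lhd> (p \<cdot> x)" "q \<rhd> (E \<lhd> x) = idc K (q \<cdot> x)" if "x \<in> Arr K" "Tgt K x = P" for x
    using arg_cong[OF pE, of "\<lambda>z. z \<lhd> x"] arg_cong[OF qE, of "\<lambda>z. z \<lhd> x"] that by simp_all
  have whisker' [simp]: "p' \<rhd> (U \<lhd> x) = u \<lhd> (p' \<cdot> x)" "q' \<rhd> (U \<lhd> x) = idc K (q' \<cdot> x)" if "x \<in> Arr K" "Tgt K x = P'" for x
    using arg_cong[OF pU, of "\<lambda>z. z \<lhd> x"] arg_cong[OF qU, of "\<lambda>z. z \<lhd> x"] that by simp_all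
  have aE: "(a \<cdot> p) \<rhd> E = a \<rhd> (e \<lhd> p)"
    using arg_cong[OF pE, of "\<lambda>z. a \<rhd> z"] by simp
  have iU: "(i \<cdot> p') \<rhd> U = i \<rhd> (u \<lhd> p')"
    using arg_cong[OF pU, of "\<lambda>z. i \<rhd> z"] by simp
  \<comment> \<open>The triangles are checked on projections: \<open>p\<close> and \<open>p'\<close>
    give those of \<open>i \<stileturn> a\<close>, while \<open>q\<close> and \<open>q'\<close> give
    identities.\<close>
  have "(E \<lhd> w) \<bullet> (w \<rhd> U) = idc K w"
  proof (rule comma_square_cells_eq[OF comma])
    show "p \<rhd> ((E \<lhd> w) \<bullet> (w \<rhd> U)) = p \<rhd> idc K w"
      using arg_cong[OF adjunction_triangles(1)[OF adj], of "\<lambda>z. z \<lhd> p'"] by (simp add: iU)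
  qed (simp_all add: hom_def cells_def qU)
  moreover have "(v \<rhd> E) \<bullet> (U \<lhd> v) = idc K v"
  proof (rule comma_square_cells_eq[OF comma'])
    show "p' \<rhd> ((v \<rhd> E) \<bullet> (U \<lhd> v)) = p' \<rhd> idc K v"
      using arg_cong[OF adjunction_triangles(2)[OF adj], of "\<lambda>z. z \<lhd> p"] by (simp add: aE)
  qed (simp_all add: hom_def cells_def qE)
  ultimately have "adjunction P' P w v U E"
    unfolding adjunction_def using v w E U by simp
  then show thesis using that pv qv qw lamv qE by blast
qed

section \<open>Exactness of mate squares\<close>

proposition mate_square_exact:
  assumes commas: "has_comma_objects K"
    and adj: "adjunction A A' i a u e" and adj': "adjunction B B' j b u' e'"
    and f: "f \<in> hom K A B" and g: "g \<in> hom K A' B'" and sq: "g \<cdot> i = j \<cdot> f"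
    and \<phi>: "\<phi> = ((b \<cdot> g) \<rhd> e) \<bullet> (u' \<lhd> (f \<cdot> a))"
  shows "exact_square K A' a g f b \<phi>"
  unfolding exact_square_def
proof (intro conjI allI impI)
  note [simp] = pasting_simps adjunctionD[OF adj] adjunctionD[OF adj']
  have [simp]: "f \<in> Arr K" "Src K f = A" "Tgt K f = B" "g \<in> Arr K" "Src K g = A'" "Tgt K g = B'"
    using f g by (auto simp: hom_def)
  note mate = mate_eqs[OF adj adj' f g sq \<phi>]
  have [simp]: "\<phi> \<in> Cell K" "Dom K \<phi> = f \<cdot> a" "Cod K \<phi> = b \<cdot> g"
    using mate(1) by (auto simp: cells_def)
  show "lax_square K A' a g f b \<phi>"
    unfolding lax_square_def using mate(1)
    by (intro exI[of _ A] exI[of _ B'] exI[of _ B]) (simp add: hom_def)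
  fix h l \<psi>
  assume pw: "pointwise_left_kan_extension K f h l \<psi>"
  then have kan: "left_kan_extension K f h l \<psi>"
    unfolding pointwise_left_kan_extension_def by blast
  then obtain C where [simp]: "h \<in> Arr K" "Src K h = A" "Tgt K h = C" "l \<in> Arr K" "Src K l = B"
    "Tgt K l = C" "\<psi> \<in> Cell K" "Dom K \<psi> = h" "Cod K \<psi> = l \<cdot> f"
    using f unfolding left_kan_extension_def by (auto simp: hom_def cells_def)
  show "pointwise_left_kan_extension K g (h \<cdot> a) (l \<cdot> b) ((l \<rhd> \<phi>) \<bullet> (\<psi> \<lhd> a))"
    unfolding pointwise_left_kan_extension_def
  proof (intro conjI allI impI)
    show "left_kan_extension K g (h \<cdot> a) (l \<cdot> b) ((l \<rhd> \<phi>) \<bullet> (\<psi> \<lhd> a))"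
      using left_kan_extension_mate[OF adj adj' g sq kan f] by (simp add: \<phi>)
    fix Z k P p q lam
    assume "k \<in> hom K Z (Tgt K g) \<and> comma_square K P p q g k lam"
    then have k: "k \<in> hom K Z B'" and comma: "comma_square K P p q g k lam" by auto
    have [simp]: "k \<in> Arr K" "Src K k = Z" "Tgt K k = B'" using k by (auto simp: hom_def)
    have [simp]: "Z \<in> Obj K" using Src_in[of k] by simp
    have bk: "b \<cdot> k \<in> hom K Z B" by (simp add: hom_def)
    \<comment> \<open>The existence of comma objects enters here: pointwiseness of
      \<open>\<psi>\<close> has to be tested against \<open>b \<cdot> k\<close>.\<close>
    then obtain P' p' q' lam' where comma': "comma_square K P' p' q' f (b \<cdot> k) lam'"
      using commas f unfolding has_comma_objects_def by blast
    obtain v w U E where adjP: "adjunction P' P w v U E" and pv: "p' \<cdot> v = a \<cdot> p"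
      and qv: "q' \<cdot> v = q" and qw: "q \<cdot> w = q'"
      and lamv: "lam' \<lhd> v = (b \<rhd> lam) \<bullet> (\<phi> \<lhd> p)" and qE: "q \<rhd> E = idc K q"
      using comma_adjunction[OF adj adj' f g sq \<phi> k comma comma'] .
    note [simp] = adjunctionD[OF adjP]
    have [simp]: "p \<in> Arr K" "Src K p = P" "Tgt K p = A'" "q \<in> Arr K" "Src K q = P" "Tgt K q = Z"
      "lam \<in> Cell K" "Dom K lam = g \<cdot> p" "Cod K lam = k \<cdot> q"
      "p' \<in> Arr K" "Src K p' = P'" "Tgt K p' = A" "q' \<in> Arr K" "Src K q' = P'" "Tgt K q' = Z"
      "lam' \<in> Cell K" "Dom K lam' = f \<cdot> p'" "Cod K lam' = b \<cdot> k \<cdot> q'"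
      using comma comma' unfolding comma_square_def lax_square_def by (auto simp: hom_def cells_def)
    have "left_kan_extension K q' (h \<cdot> p') (l \<cdot> b \<cdot> k) ((l \<rhd> lam') \<bullet> (\<psi> \<lhd> p'))"
      using pw bk comma' unfolding pointwise_left_kan_extension_def by simp
    \<comment> \<open>Since \<open>q \<rhd> E\<close> and the unit on \<open>Z\<close> are
      identities, the mate cell vanishes and only whiskering by \<open>v\<close> remains;
      \<open>pv\<close> and \<open>lamv\<close> then turn the result into the required cell.\<close>
    from left_kan_extension_mate[OF adjP adjunction_id[of Z] _ _ this, of q]
    have "left_kan_extension K q (h \<cdot> p' \<cdot> v) (l \<cdot> b \<cdot> k) ((l \<rhd> (lam' \<lhd> v)) \<bullet> (\<psi> \<lhd> (p' \<cdot> v)))"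
      by (simp add: hom_def qw qv qE)
    then show "left_kan_extension K q ((h \<cdot> a) \<cdot> p) ((l \<cdot> b) \<cdot> k)
        (((l \<cdot> b) \<rhd> lam) \<bullet> (((l \<rhd> \<phi>) \<bullet> (\<psi> \<lhd> a)) \<lhd> p))"
      by (simp add: pv lamv)
  qed
qed

end

section \<open>Rewrite rules for the data of a 2-monad\<close>

context two_monad
begin

lemma far_T_simps:
  assumes "f \<in> Arr K"
  shows "far T f \<in> Arr K" "Src K (far T f) = fob T (Src K f)" "Tgt K (far T f) = fob T (Tgt K f)"
  using functor_T Arr_homI[OF assms] unfolding two_functor_def by (auto simp: hom_def)

lemma fob_T_simp: "A \<in> Obj K \<Longrightarrow> fob T A \<in> Obj K"
  using functor_T unfolding two_functor_def by auto

lemma fce_T_simps: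
  assumes "\<alpha> \<in> Cell K"
  shows "fce T \<alpha> \<in> Cell K" "Dom K (fce T \<alpha>) = far T (Dom K \<alpha>)" "Cod K (fce T \<alpha>) = far T (Cod K \<alpha>)"
  using functor_T Cell_cellsI[OF assms] unfolding two_functor_def by (auto simp: cells_def)

lemma far_T_comp_simps:
  "A \<in> Obj K \<Longrightarrow> far T (ida K A) = ida K (fob T A)"
  "\<lbrakk>f \<in> Arr K; g \<in> Arr K; Src K g = Tgt K f\<rbrakk> \<Longrightarrow> far T (g \<cdot> f) = far T g \<cdot> far T f"
  using functor_T Arr_homI unfolding two_functor_def by metis+

lemma fce_T_comp_simps:
  "f \<in> Arr K \<Longrightarrow> fce T (idc K f) = idc K (far T f)"
  "\<lbrakk>\<alpha> \<in> Cell K; \<beta> \<in> Cell K; Dom K \<beta> = Cod K \<alpha>\<rbrakk> \<Longrightarrow> fce T (\<beta> \<bullet> \<alpha>) = fce T \<beta> \<bullet> fce T \<alpha>"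
  using functor_T Cell_cellsI unfolding two_functor_def by metis+

lemma eta_simps:
  assumes "A \<in> Obj K"
  shows "\<eta> A \<in> Arr K" "Src K (\<eta> A) = A" "Tgt K (\<eta> A) = fob T A"
  using natural_eta assms unfolding two_natural_def by (auto simp: hom_def id_endo_def)

lemma mu_simps:
  assumes "A \<in> Obj K"
  shows "\<mu> A \<in> Arr K" "Src K (\<mu> A) = fob T (fob T A)" "Tgt K (\<mu> A) = fob T A"
  using natural_mu assms unfolding two_natural_def by (auto simp: hom_def comp_endo_def)

lemma eta_natural: "f \<in> hom K A B \<Longrightarrow> far T f \<cdot> \<eta> A = \<eta> B \<cdot> f"
  using natural_eta unfolding two_natural_def by (auto simp: id_endo_def)

lemma eta_natural_cell:
  "\<lbrakk>f \<in> hom K A B; \<alpha> \<in> cells K f g\<rbrakk> \<Longrightarrow> fce T \<alpha> \<lhd> \<eta> A = \<eta> B \<rhd> \<alpha>"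
  using natural_eta unfolding two_natural_def by (auto simp: id_endo_def)

lemmas monad_simps = pasting_simps far_T_simps fob_T_simp fce_T_simps far_T_comp_simps
  fce_T_comp_simps eta_simps mu_simps mu_T_eta mu_eta_T

end

section \<open>Pseudo algebras and colax morphisms of a colax idempotent 2-monad\<close>

context colax_idempotent_two_monad
begin

text \<open>The unit \<open>u\<close> of \<open>\<eta>T \<stileturn> \<mu>\<close> is a 2-cell on the identity, but not assumed to be
  the identity; replacing the counit \<open>e\<close> by \<open>e \<bullet> \<eta> u \<mu>\<close> normalises it.\<close>

lemma normalised_counit:
  assumes A: "A \<in> Obj K"
  obtains e where "e \<in> cells K (\<eta> (fob T A) \<cdot> \<mu> A) (ida K (fob T (fob T A)))"
    "\<mu> A \<rhd> e = idc K (\<mu> A)" "e \<lhd> \<eta> (fob T A) = idc K (\<eta> (fob T A))"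
proof -
  note [simp] = monad_simps
  obtain u e
    where mu: "modification K T T (\<lambda>A. ida K (fob T A)) (\<lambda>A. \<mu> A \<cdot> \<eta> (fob T A)) u"
      and me: "modification K (comp_endo T T) (comp_endo T T) (\<lambda>A. \<eta> (fob T A) \<cdot> \<mu> A)
        (\<lambda>A. ida K (fob (comp_endo T T) A)) e"
      and "\<forall>A\<in>Obj K. (e A \<lhd> \<eta> (fob T A)) \<bullet> (\<eta> (fob T A) \<rhd> u A) = idc K (\<eta> (fob T A))"
      and "\<forall>A\<in>Obj K. (\<mu> A \<rhd> e A) \<bullet> (u A \<lhd> \<mu> A) = idc K (\<mu> A)"
    using eta_T_adjoint_mu unfolding two_natural_adjoint_def by blast
  then have triangles: "(e A \<lhd> \<eta> (fob T A)) \<bullet> (\<eta> (fob T A) \<rhd> u A) = idc K (\<eta> (fob T A))"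
    "(\<mu> A \<rhd> e A) \<bullet> (u A \<lhd> \<mu> A) = idc K (\<mu> A)"
    using A by auto
  have [simp]: "A \<in> Obj K" by fact
  have "u A \<in> cells K (ida K (fob T A)) (\<mu> A \<cdot> \<eta> (fob T A))"
    "e A \<in> cells K (\<eta> (fob T A) \<cdot> \<mu> A) (ida K (fob T (fob T A)))"
    using mu me A unfolding modification_def by (auto simp: comp_endo_def)
  then have [simp]: "u A \<in> Cell K" "Dom K (u A) = ida K (fob T A)" "Cod K (u A) = ida K (fob T A)"
    "e A \<in> Cell K" "Dom K (e A) = \<eta> (fob T A) \<cdot> \<mu> A" "Cod K (e A) = ida K (fob T (fob T A))"
    by (auto simp: cells_def)
  have [simp]: "\<mu> A \<cdot> (\<eta> (fob T A) \<cdot> x) = x" if "x \<in> Arr K" "Tgt K x = fob T A" for x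
    using cmp_assoc_simp[of x "\<eta> (fob T A)" "\<mu> A"] that by simp
  define e' where "e' = e A \<bullet> (\<eta> (fob T A) \<rhd> (u A \<lhd> \<mu> A))"
  have "e' \<in> cells K (\<eta> (fob T A) \<cdot> \<mu> A) (ida K (fob T (fob T A)))"
    by (simp add: e'_def cells_def)
  \<comment> \<open>As \<open>\<mu> A \<cdot> \<eta> (fob T A)\<close> is an identity, both
    whiskerings of \<open>e'\<close> collapse to the original triangles.\<close>
  moreover have "\<mu> A \<rhd> e' = idc K (\<mu> A)" "e' \<lhd> \<eta> (fob T A) = idc K (\<eta> (fob T A))"
    using triangles by (simp_all add: e'_def)
  ultimately show thesis using that by blast
qed

text \<open>The comparison is the normalised counit whiskered by \<open>far T (\<eta> A)\<close>;
  its source is \<open>\<eta> (fob T A)\<close> because of \<open>mu_T_eta\<close>.\<close>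

lemma T_eta_comparison:
  assumes A: "A \<in> Obj K"
  obtains c where "c \<in> cells K (\<eta> (fob T A)) (far T (\<eta> A))"
    "\<mu> A \<rhd> c = idc K (ida K (fob T A))" "c \<lhd> \<eta> A = idc K (\<eta> (fob T A) \<cdot> \<eta> A)"
proof -
  note [simp] = monad_simps
  obtain e where e: "e \<in> cells K (\<eta> (fob T A) \<cdot> \<mu> A) (ida K (fob T (fob T A)))"
    and e1: "\<mu> A \<rhd> e = idc K (\<mu> A)" and e2: "e \<lhd> \<eta> (fob T A) = idc K (\<eta> (fob T A))"
    using normalised_counit[OF A] .
  have [simp]: "A \<in> Obj K" "e \<in> Cell K" "Dom K e = \<eta> (fob T A) \<cdot> \<mu> A" "Cod K e = ida K (fob T (fob T A))"
    using A e by (auto simp: cells_def)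
  have nat [simp]: "far T (\<eta> A) \<cdot> \<eta> A = \<eta> (fob T A) \<cdot> \<eta> A"
    by (intro eta_natural) (simp add: hom_def)
  have "e \<lhd> far T (\<eta> A) \<in> cells K (\<eta> (fob T A)) (far T (\<eta> A))"
    by (simp add: cells_def)
  moreover have "\<mu> A \<rhd> (e \<lhd> far T (\<eta> A)) = idc K (ida K (fob T A))"
    using arg_cong[OF e1, of "\<lambda>z. z \<lhd> far T (\<eta> A)"] by simp
  moreover have "(e \<lhd> far T (\<eta> A)) \<lhd> \<eta> A = idc K (\<eta> (fob T A) \<cdot> \<eta> A)"
    using arg_cong[OF e2, of "\<lambda>z. z \<lhd> \<eta> A"] by simp
  ultimately show thesis using that by blast
qed

text \<open>The counit is \<open>\<eta> a = T a \<cdot> \<eta> T \<rightarrow> T a \<cdot> T \<eta>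
  = T (a \<eta>) \<rightarrow> 1\<close>, built from the comparison \<open>c\<close> and the image
  under \<open>T\<close> of the inverse of \<open>a0\<close>.\<close>

proposition pseudo_algebra_adjunction:
  assumes alg: "pseudo_algebra K T \<eta> \<mu> A a a0 a2"
  obtains e where "adjunction A (fob T A) (\<eta> A) a a0 e"
proof -
  note [simp] = monad_simps
  have [simp]: "A \<in> Obj K" "a \<in> Arr K" "Src K a = fob T A" "Tgt K a = A"
    "a0 \<in> Cell K" "Dom K a0 = ida K A" "Cod K a0 = a \<cdot> \<eta> A"
    "a2 \<in> Cell K" "Dom K a2 = a \<cdot> far T a" "Cod K a2 = a \<cdot> \<mu> A"
    using alg unfolding pseudo_algebra_def invertible_cell_def by (auto simp: hom_def cells_def)
  have unit1: "(a2 \<lhd> \<eta> (fob T A)) \<bullet> (a0 \<lhd> a) = idc K a"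
    and unit2: "(a2 \<lhd> far T (\<eta> A)) \<bullet> (a \<rhd> fce T a0) = idc K a"
    using alg unfolding pseudo_algebra_def by auto
  obtain a0' where "a0' \<in> cells K (a \<cdot> \<eta> A) (ida K A)"
    and inv: "a0' \<bullet> a0 = idc K (ida K A)" "a0 \<bullet> a0' = idc K (a \<cdot> \<eta> A)"
    using alg unfolding pseudo_algebra_def invertible_cell_def by auto
  then have [simp]: "a0' \<in> Cell K" "Dom K a0' = a \<cdot> \<eta> A" "Cod K a0' = ida K A"
    by (auto simp: cells_def)
  obtain c where "c \<in> cells K (\<eta> (fob T A)) (far T (\<eta> A))"
    and \<mu>c: "\<mu> A \<rhd> c = idc K (ida K (fob T A))" and c\<eta>: "c \<lhd> \<eta> A = idc K (\<eta> (fob T A) \<cdot> \<eta> A)"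
    using T_eta_comparison[of A] by auto
  then have [simp]: "c \<in> Cell K" "Dom K c = \<eta> (fob T A)" "Cod K c = far T (\<eta> A)"
    by (auto simp: cells_def)
  have nat_a: "far T a \<cdot> \<eta> (fob T A) = \<eta> A \<cdot> a"
    by (intro eta_natural) (simp add: hom_def)
  have nat_a': "far T a \<cdot> (\<eta> (fob T A) \<cdot> x) = \<eta> A \<cdot> (a \<cdot> x)" if "x \<in> Arr K" "Tgt K x = fob T A" for x
    using arg_cong[OF nat_a, of "\<lambda>z. z \<cdot> x"] that by simp
  note [simp] = nat_a nat_a'
  have nat_a0: "fce T a0 \<lhd> \<eta> A = \<eta> A \<rhd> a0"
    by (intro eta_natural_cell) (simp_all add: hom_def cells_def)
  define e where "e = fce T a0' \<bullet> (far T a \<rhd> c)"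
  have [simp]: "e \<in> Cell K" "Dom K e = \<eta> A \<cdot> a" "Cod K e = ida K (fob T A)"
    by (simp_all add: e_def)
  have Tinv: "fce T a0' \<bullet> fce T a0 = idc K (ida K (fob T A))"
    "fce T a0 \<bullet> fce T a0' = idc K (far T a \<cdot> far T (\<eta> A))"
    using arg_cong[OF inv(1), of "fce T"] arg_cong[OF inv(2), of "fce T"] by simp_all
  have "e \<lhd> \<eta> A = fce T a0' \<lhd> \<eta> A"
  proof -
    have "far T a \<rhd> (c \<lhd> \<eta> A) = idc K (\<eta> A \<cdot> (a \<cdot> \<eta> A))"
      by (simp add: c\<eta>)
    moreover have "far T (a \<cdot> \<eta> A) \<cdot> \<eta> A = \<eta> A \<cdot> (a \<cdot> \<eta> A)"
      by (intro eta_natural) (simp add: hom_def)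
    ultimately show ?thesis by (simp add: e_def)
  qed
  then have "(e \<lhd> \<eta> A) \<bullet> (\<eta> A \<rhd> a0) = (fce T a0' \<bullet> fce T a0) \<lhd> \<eta> A"
    by (simp add: nat_a0 del: fce_T_comp_simps)
  also have "\<dots> = idc K (\<eta> A)" unfolding Tinv by simp
  finally have "(e \<lhd> \<eta> A) \<bullet> (\<eta> A \<rhd> a0) = idc K (\<eta> A)" .
  moreover have "(a \<rhd> e) \<bullet> (a0 \<lhd> a) = idc K a"
  proof -
    \<comment> \<open>By \<open>unit2\<close> this cell is
      \<open>a2 \<lhd> far T (\<eta> A)\<close>. Sliding \<open>c\<close> past \<open>a2\<close>
      then replaces \<open>far T (\<eta> A)\<close> by \<open>\<eta> (fob T A)\<close>, where
      \<open>unit1\<close> applies.\<close>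
    have "a \<rhd> fce T a0' = ((a2 \<lhd> far T (\<eta> A)) \<bullet> (a \<rhd> fce T a0)) \<bullet> (a \<rhd> fce T a0')"
      unfolding unit2 by simp
    also have "\<dots> = (a2 \<lhd> far T (\<eta> A)) \<bullet> (a \<rhd> (fce T a0 \<bullet> fce T a0'))" by simp
    also have "\<dots> = a2 \<lhd> far T (\<eta> A)" unfolding Tinv by simp
    finally have "a \<rhd> e = (a2 \<lhd> far T (\<eta> A)) \<bullet> ((a \<cdot> far T a) \<rhd> c)" by (simp add: e_def)
    also have "\<dots> = (a \<rhd> (\<mu> A \<rhd> c)) \<bullet> (a2 \<lhd> \<eta> (fob T A))"
      using whisker_exchange[of c a2] by simp
    also have "\<dots> = a2 \<lhd> \<eta> (fob T A)" unfolding \<mu>c by simp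
    finally show ?thesis using unit1 by simp
  qed
  ultimately have "adjunction A (fob T A) (\<eta> A) a a0 e"
    unfolding adjunction_def by (simp add: hom_def cells_def)
  then show thesis using that by blast
qed

text \<open>The unit axiom alone determines the structure cell of a colax morphism, as the mate of the
  naturality square of \<open>\<eta>\<close>.\<close>

lemma colax_morphism_mate:
  assumes mor: "colax_morphism K T \<eta> \<mu> A a a0 a2 B b b0 b2 f fbar"
    and adj: "adjunction A (fob T A) (\<eta> A) a a0 e" and adj': "adjunction B (fob T B) (\<eta> B) b b0 e'"
  shows "fbar = ((b \<cdot> far T f) \<rhd> e) \<bullet> (b0 \<lhd> (f \<cdot> a))"
proof -
  have f: "f \<in> hom K A B" and fbar: "fbar \<in> cells K (f \<cdot> a) (b \<cdot> far T f)"
    and unit: "(fbar \<lhd> \<eta> A) \<bullet> (f \<rhd> a0) = b0 \<lhd> f"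
    using mor unfolding colax_morphism_def by auto
  note [simp] = monad_simps adjunctionD[OF adj] adjunctionD[OF adj']
  have [simp]: "f \<in> Arr K" "Src K f = A" "Tgt K f = B" using f by (auto simp: hom_def)
  have "b \<cdot> far T f \<in> hom K (fob T A) B" by (simp add: hom_def)
  \<comment> \<open>The unit axiom says that the transpose of \<open>fbar\<close> along
    \<open>\<eta> A \<stileturn> a\<close> is \<open>b0 \<lhd> f\<close>; transposing back gives the
    mate.\<close>
  from transpose_inverse_left[OF adj f this fbar] show ?thesis unfolding unit by simp
qed

end

theorem proposition4p4p1:
  fixes K :: "('o, 'm, 'c) two_cat"
    and T :: "('o, 'm, 'c) endo"
    and \<eta> \<mu> :: "'o \<Rightarrow> 'm"
  assumes "colax_idempotent_two_monad K T \<eta> \<mu>"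
    and "has_comma_objects K"
    and "pseudo_algebra K T \<eta> \<mu> A a a0 a2"
    and "pseudo_algebra K T \<eta> \<mu> B b b0 b2"
    and "colax_morphism K T \<eta> \<mu> A a a0 a2 B b b0 b2 f fbar"
  shows "exact_colax_morphism K T A a b f fbar"
proof -
  interpret colax_idempotent_two_monad K T \<eta> \<mu> by fact
  obtain e where adj: "adjunction A (fob T A) (\<eta> A) a a0 e"
    using pseudo_algebra_adjunction[OF assms(3)] .
  obtain e' where adj': "adjunction B (fob T B) (\<eta> B) b b0 e'"
    using pseudo_algebra_adjunction[OF assms(4)] .
  have f: "f \<in> hom K A B" using assms(5) unfolding colax_morphism_def by simp
  then have "far T f \<in> hom K (fob T A) (fob T B)" by (simp add: hom_def far_T_simps)
  \<comment> \<open>The commuting square is the naturality of \<open>\<eta>\<close> at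
    \<open>f\<close>, and \<open>fbar\<close> is its mate.\<close>
  then show ?thesis
    unfolding exact_colax_morphism_def
    using mate_square_exact[OF assms(2) adj adj' f _ eta_natural[OF f]]
      colax_morphism_mate[OF assms(5) adj adj'] by blast
qed

end
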